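(* Let $K/k$ be a finite abelian extension of number fields with Galois group $G$, let $S$ be a finite set of places of $k$ containing all infinite places, and let $\mathcal{A}$ be an Artin system of $S_K$-units. For $\chi\in\widehat{G}$ put $$A(\chi,\mathcal{A})=\frac{L_{K,S}^{*}(0,\chi)}{R(\chi,\mathcal{A})},\qquad \beta_S(\mathcal{A})=\sum_{\chi\in\widehat{G}}A(\chi,\mathcal{A})\cdot e_{\overline{\chi}}\in\mathbb{C}[G].$$ Then the following are equivalent: (a) (Stark's conjecture over $\mathbb{Q}$ for all $\chi\in\widehat{G}$) for every $\chi\in\widehat{G}$ one has $A(\chi,\mathcal{A})\in\overline{\mathbb{Q}}$, and $A(\chi,\mathcal{A})^{g}=A(\chi^{g},\mathcal{A})$ for all $g\in\mathrm{Gal}(\overline{\mathbb{Q}}/\mathbb{Q})$; (b) $\beta_S(\mathcal{A})\in\mathbb{Q}[G]$.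
   Context: Setting: $K/k$ is a finite abelian extension of number fields, $G=\mathrm{Gal}(K/k)$, $\widehat{G}$ is the group of complex characters of $G$, and $\chi^g=g\circ\chi$ for $g\in\mathrm{Gal}(\overline{\mathbb{Q}}/\mathbb{Q})$ ($\overline{\mathbb{Q}}\subset\mathbb{C}$). $S$ is a finite set of places of $k$ containing all infinite places, and $S_K$ is the set of places of $K$ above places in $S$. $G_v$ and $I_v$ are the decomposition and inertia groups of a place $v$ of $k$, $\kappa(v)$ is the residue field of a finite place $v$ and $\mathbb{N}(v)=|\kappa(v)|$. Absolute values $|\cdot|_w$ on $K$ are normalized: usual absolute value for real $w$, its square for complex $w$, and $\mathbb{N}(\mathfrak{P})^{-\mathrm{ord}_{\mathfrak{P}}(\cdot)}$ for finite $w=\mathfrak{P}$. $E_S(K)$ is the group of $S_K$-units of $K$. For a $\mathbb{Z}[G]$-module $M$, $\mathbb{C}M=\mathbb{C}\otimes_{\mathbb{Z}}M$. $e_\chi=\frac{1}{|G|}\sum_{\sigma\in G}\chi(\sigma)\sigma^{-1}$. $L$-functions: for a place $v$, let $\sigma_v\in G_v$ be a lift of the Frobenius in $G_v/I_v$ and $Fr_v=\frac{1}{|I_v|}\sigma_v\sum_{h\in I_v}h\in\mathbb{Q}[G]$. $L_{K,S}(s,\chi)$ is the meromorphic continuation of $\prod_{v\notin S}(1-\chi(Fr_v)\mathbb{N}(v)^{-s})^{-1}$, $\mathrm{Re}(s)>1$. $L^*_{K,S}(0,\chi)$ is the leading (first nonzero) coefficient of its Taylor expansion at $s=0$. Modules: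 $Y_S(K)$ is the free abelian group on $S_K$, $s_K:Y_S(K)\to\mathbb{Z}$ is the augmentation ($w\mapsto1$), and $X_S(K)=\ker s_K$. The logarithmic map $\lambda_{K,S}:\mathbb{C}E_S(K)\to\mathbb{C}X_S(K)$ is the isomorphism of $\mathbb{C}[G]$-modules induced by $u\mapsto-\sum_{w\in S_K}\log|u|_w\cdot w$. Artin system: an Artin system of $S_K$-units is a collection $\mathcal{A}=\{\varepsilon_w\mid w\in S_K\}\subseteq E_S(K)$ such that the group morphism $f:Y_S(K)\to E_S(K)$, $w\mapsto\varepsilon_w$, is $G$-equivariant and $\ker f=\mathbb{Z}\cdot\alpha$ for some $\alpha\in Y_S(K)^G$ with $s_K(\alpha)\neq0$. $f_{\mathbb{C}}$ is the induced map $\mathbb{C}Y_S(K)\to\mathbb{C}E_S(K)$. Stark regulator: for $\chi\in\widehat{G}$, $R(\chi,\mathcal{A})=\det\left((f_{\mathbb{C}}\circ\lambda_{K,S})^{\overline{\chi}}\right)$, the determinant of the restriction of the automorphism $f_{\mathbb{C}}\circ\lambda_{K,S}$ to the $\mathbb{C}$-vector space $\mathbb{C}E_S(K)\cdot e_{\overline{\chi}}$ (in particular it is nonzero). *)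

theory Defs
  imports
    "HOL-Complex_Analysis.Complex_Analysis"
    "HOL-Algebra.Bij"
    "HOL-Algebra.Free_Abelian_Groups"
    "HOL-Algebra.Ideal_Product"
    "HOL-Algebra.Multiplicative_Group"
    "HOL-Algebra.QuotRing"
    "Jordan_Normal_Form.Missing_VectorSpace"
    "Jordan_Normal_Form.Determinant"
begin

section \<open>Number fields, Galois groups, characters\<close>

text \<open>Fields, rings of integers and the like are subsets of an ambient type of class
  \<^class>\<open>field_char_0\<close>; \<open>ring_on F\<close> makes such a subset available to HOL-Algebra.\<close>

definition ring_on :: "'a::comm_ring_1 set \<Rightarrow> 'a ring" where
  "ring_on F = \<lparr>carrier = F, monoid.mult = (*), one = 1, ring.zero = 0, ring.add = (+)\<rparr>"

abbreviation complex_field :: "complex ring" where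
  "complex_field \<equiv> ring_on UNIV"

definition number_field :: "'a::field_char_0 set \<Rightarrow> bool" where
  "number_field F \<longleftrightarrow> field (ring_on F) \<and>
     (\<exists>B. finite B \<and> F = Modules.module.span (\<lambda>(q::rat) x. of_rat q * x) B)"

definition galois_group :: "'a::field_char_0 set \<Rightarrow> 'a set \<Rightarrow> ('a \<Rightarrow> 'a) monoid" where
  "galois_group k K = BijGroup K
     \<lparr>carrier := {\<sigma> \<in> ring_iso (ring_on K) (ring_on K) \<inter> extensional K. \<forall>x\<in>k. \<sigma> x = x}\<rparr>"

definition abelian_extension :: "'a::field_char_0 set \<Rightarrow> 'a set \<Rightarrow> bool" where
  "abelian_extension k K \<longleftrightarrow>
     k \<subseteq> K \<and> {x \<in> K. \<forall>\<sigma>\<in>carrier (galois_group k K). \<sigma> x = x} = k \<and>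
     comm_group (galois_group k K)"

definition Qbar :: "complex set" where
  "Qbar = {z. algebraic z}"

abbreviation absolute_galois_group :: "(complex \<Rightarrow> complex) monoid" where
  "absolute_galois_group \<equiv> galois_group \<rat> Qbar"

definition characters :: "('g, 'b) monoid_scheme \<Rightarrow> ('g \<Rightarrow> complex) set" where
  "characters G = hom G (mult_of complex_field) \<inter> extensional (carrier G)"

definition conj_char :: "('g, 'b) monoid_scheme \<Rightarrow> ('g \<Rightarrow> complex) \<Rightarrow> 'g \<Rightarrow> complex" where
  "conj_char G \<psi> = compose (carrier G) cnj \<psi>"

text \<open>The group ring \<open>R[G]\<close>, for \<open>R\<close> a subring of the complex numbers, consists of the
  coefficient functions with values in \<open>R\<close> that vanish outside \<open>carrier G\<close>
  (only used for finite \<open>G\<close>).\<close>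

definition group_ring :: "complex set \<Rightarrow> ('g, 'b) monoid_scheme \<Rightarrow> ('g \<Rightarrow> complex) set" where
  "group_ring R G = {a. (\<forall>\<sigma>\<in>carrier G. a \<sigma> \<in> R) \<and> (\<forall>\<sigma>. \<sigma> \<notin> carrier G \<longrightarrow> a \<sigma> = 0)}"

definition gr_of :: "'g \<Rightarrow> 'g \<Rightarrow> complex" where
  "gr_of \<sigma> = (\<lambda>\<tau>. if \<tau> = \<sigma> then 1 else 0)"

definition gr_mult ::
    "('g, 'b) monoid_scheme \<Rightarrow> ('g \<Rightarrow> complex) \<Rightarrow> ('g \<Rightarrow> complex) \<Rightarrow> 'g \<Rightarrow> complex" where
  "gr_mult G a b =
     (\<lambda>\<tau>. \<Sum>\<sigma>\<in>carrier G. \<Sum>\<rho>\<in>carrier G. a \<sigma> * b \<rho> * gr_of (\<sigma> \<otimes>\<^bsub>G\<^esub> \<rho>) \<tau>)"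

definition gr_eval :: "('g, 'b) monoid_scheme \<Rightarrow> ('g \<Rightarrow> complex) \<Rightarrow> ('g \<Rightarrow> complex) \<Rightarrow> complex" where
  "gr_eval G \<psi> a = (\<Sum>\<sigma>\<in>carrier G. a \<sigma> * \<psi> \<sigma>)"

definition char_idempotent :: "('g, 'b) monoid_scheme \<Rightarrow> ('g \<Rightarrow> complex) \<Rightarrow> 'g \<Rightarrow> complex" where
  "char_idempotent G \<psi> =
     (\<lambda>\<tau>. 1 / of_nat (card (carrier G)) * (\<Sum>\<sigma>\<in>carrier G. \<psi> \<sigma> * gr_of (inv\<^bsub>G\<^esub> \<sigma>) \<tau>))"


section \<open>Places\<close>

definition integers_of :: "'a::field_char_0 set \<Rightarrow> 'a set" where
  "integers_of F = {x \<in> F. algebraic_int x}"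

definition embeddings :: "'a::field_char_0 set \<Rightarrow> ('a \<Rightarrow> complex) set" where
  "embeddings F = Ring.ring_hom (ring_on F) complex_field \<inter> extensional F"

text \<open>A finite place is a nonzero prime ideal of the ring of integers; an infinite place is
  a set consisting of a complex embedding and its complex conjugate.\<close>

datatype 'a place = Finite_Place (place_prime: "'a set") | Infinite_Place "('a \<Rightarrow> complex) set"

definition finite_places :: "'a::field_char_0 set \<Rightarrow> 'a place set" where
  "finite_places F = {Finite_Place P | P. primeideal P (ring_on (integers_of F)) \<and> P \<noteq> {0}}"

definition infinite_places :: "'a::field_char_0 set \<Rightarrow> 'a place set" where
  "infinite_places F = {Infinite_Place {\<tau>, compose F cnj \<tau>} | \<tau>. \<tau> \<in> embeddings F}"

definition places :: "'a::field_char_0 set \<Rightarrow> 'a place set" where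
  "places F = finite_places F \<union> infinite_places F"

fun restrict_place :: "'a set \<Rightarrow> 'a place \<Rightarrow> 'a place" where
  "restrict_place k (Finite_Place P) = Finite_Place (P \<inter> k)"
| "restrict_place k (Infinite_Place T) = Infinite_Place ((\<lambda>\<tau>. restrict \<tau> k) ` T)"

definition places_above :: "'a::field_char_0 set \<Rightarrow> 'a set \<Rightarrow> 'a place set \<Rightarrow> 'a place set" where
  "places_above k K S = {w \<in> places K. restrict_place k w \<in> S}"

text \<open>The left action of \<open>\<sigma> \<in> Gal(K/k)\<close>, characterised by \<open>|\<sigma> x|\<^bsub>\<sigma>w\<^esub> = |x|\<^bsub>w\<^esub>\<close>.\<close>

fun place_act :: "'a set \<Rightarrow> ('a \<Rightarrow> 'a) \<Rightarrow> 'a place \<Rightarrow> 'a place" where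
  "place_act K \<sigma> (Finite_Place P) = Finite_Place (\<sigma> ` P)"
| "place_act K \<sigma> (Infinite_Place T) = Infinite_Place ((\<lambda>\<tau>. compose K \<tau> (inv_into K \<sigma>)) ` T)"

definition ideal_norm :: "'a::field_char_0 set \<Rightarrow> 'a set \<Rightarrow> nat" where
  "ideal_norm F P = card (carrier (ring_on (integers_of F) Quot P))"

text \<open>The order at \<open>P\<close> of a nonzero integer, and its extension to quotients of these.\<close>

definition prime_ord_int :: "'a::field_char_0 set \<Rightarrow> 'a set \<Rightarrow> 'a \<Rightarrow> nat" where
  "prime_ord_int F P a =
     (GREATEST n. a \<in> P [^]\<^bsub>ideals_set (ring_on (integers_of F))\<^esub> (n::nat))"

definition prime_ord :: "'a::field_char_0 set \<Rightarrow> 'a set \<Rightarrow> 'a \<Rightarrow> int" where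
  "prime_ord F P x =
     (THE m. \<exists>a b. a \<in> integers_of F - {0} \<and> b \<in> integers_of F - {0} \<and> x = a / b \<and>
        m = int (prime_ord_int F P a) - int (prime_ord_int F P b))"

fun place_abs :: "'a::field_char_0 set \<Rightarrow> 'a place \<Rightarrow> 'a \<Rightarrow> real" where
  "place_abs F (Finite_Place P) x =
     (if x = 0 then 0 else real (ideal_norm F P) powi (- prime_ord F P x))"
| "place_abs F (Infinite_Place T) x =
     (let \<tau> = (SOME \<tau>. \<tau> \<in> T)
      in if \<tau> ` F \<subseteq> \<real> then cmod (\<tau> x) else (cmod (\<tau> x))\<^sup>2)"


section \<open>Frobenius elements and L-functions\<close>

text \<open>Decomposition group, inertia group and Frobenius of a place \<open>v\<close> of \<open>k\<close> are those of a
  chosen place of \<open>K\<close> above \<open>v\<close>; for abelian \<open>K/k\<close> the groups, and the Frobenius modulo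
  inertia, do not depend on the choice. Inertia, Frobenius and \<open>Fr_elem\<close> are meaningful for
  finite places only.\<close>

definition place_over :: "'a::field_char_0 set \<Rightarrow> 'a set \<Rightarrow> 'a place \<Rightarrow> 'a place" where
  "place_over k K v = (SOME w. w \<in> places K \<and> restrict_place k w = v)"

definition decomposition_group ::
    "'a::field_char_0 set \<Rightarrow> 'a set \<Rightarrow> 'a place \<Rightarrow> ('a \<Rightarrow> 'a) set" where
  "decomposition_group k K v =
     {\<sigma> \<in> carrier (galois_group k K). place_act K \<sigma> (place_over k K v) = place_over k K v}"

definition inertia_group ::
    "'a::field_char_0 set \<Rightarrow> 'a set \<Rightarrow> 'a place \<Rightarrow> ('a \<Rightarrow> 'a) set" where
  "inertia_group k K v =
     {\<sigma> \<in> decomposition_group k K v.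
        \<forall>x\<in>integers_of K. \<sigma> x - x \<in> place_prime (place_over k K v)}"

definition place_norm :: "'a::field_char_0 set \<Rightarrow> 'a place \<Rightarrow> nat" where
  "place_norm k v = ideal_norm k (place_prime v)"

definition frobenius_lift :: "'a::field_char_0 set \<Rightarrow> 'a set \<Rightarrow> 'a place \<Rightarrow> 'a \<Rightarrow> 'a" where
  "frobenius_lift k K v =
     (SOME \<sigma>. \<sigma> \<in> decomposition_group k K v \<and>
        (\<forall>x\<in>integers_of K. \<sigma> x - x ^ place_norm k v \<in> place_prime (place_over k K v)))"

definition Fr_elem ::
    "'a::field_char_0 set \<Rightarrow> 'a set \<Rightarrow> 'a place \<Rightarrow> ('a \<Rightarrow> 'a) \<Rightarrow> complex" where
  "Fr_elem k K v =
     (\<lambda>\<tau>. 1 / of_nat (card (inertia_group k K v)) *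
        gr_mult (galois_group k K) (gr_of (frobenius_lift k K v))
          (\<lambda>\<rho>. \<Sum>h\<in>inertia_group k K v. gr_of h \<rho>) \<tau>)"

text \<open>The Euler product is the unordered one, i.e. the limit of the products over the finite
  sets of places outside \<open>S\<close>. Nice meromorphy normalises the value at a pole to \<open>0\<close> and fills
  in removable singularities, so that the continuation is unique as a function.\<close>

definition L_function ::
    "'a::field_char_0 set \<Rightarrow> 'a set \<Rightarrow> 'a place set \<Rightarrow> (('a \<Rightarrow> 'a) \<Rightarrow> complex) \<Rightarrow> complex \<Rightarrow> complex"
  where
  "L_function k K S \<psi> =
     (THE L. L nicely_meromorphic_on UNIV \<and>
        (\<forall>s. Re s > 1 \<longrightarrow>
          ((\<lambda>V. \<Prod>v\<in>V. inverse (1 - gr_eval (galois_group k K) \<psi> (Fr_elem k K v)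
                                       * of_nat (place_norm k v) powr (- s)))
            \<longlongrightarrow> L s) (finite_subsets_at_top (places k - S))))"

definition L_leading_coeff ::
    "'a::field_char_0 set \<Rightarrow> 'a set \<Rightarrow> 'a place set \<Rightarrow> (('a \<Rightarrow> 'a) \<Rightarrow> complex) \<Rightarrow> complex" where
  "L_leading_coeff k K S \<psi> =
     (let F = fps_expansion (L_function k K S \<psi>) 0 in fps_nth F (subdegree F))"


section \<open>Complexification of abelian groups\<close>

text \<open>For an abelian group \<open>M\<close> (written multiplicatively, as all groups in HOL-Algebra),
  \<open>\<complex> \<otimes>\<^bsub>\<int>\<^esub> M\<close> is the complex vector space with basis \<open>M\<close> modulo the subspace spanned by all
  \<open>[m m'] - [m] - [m']\<close>. Its elements are the cosets.\<close>

definition cscale :: "complex \<Rightarrow> ('m \<Rightarrow>\<^sub>0 complex) \<Rightarrow> ('m \<Rightarrow>\<^sub>0 complex)" where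
  "cscale c = Poly_Mapping.map ((*) c)"

definition tensor_rel :: "('m, 'b) monoid_scheme \<Rightarrow> ('m \<Rightarrow>\<^sub>0 complex) set" where
  "tensor_rel M = Modules.module.span cscale
     {Poly_Mapping.single (m \<otimes>\<^bsub>M\<^esub> m') 1 - Poly_Mapping.single m 1 - Poly_Mapping.single m' 1
       | m m'. m \<in> carrier M \<and> m' \<in> carrier M}"

definition tensor_class ::
    "('m, 'b) monoid_scheme \<Rightarrow> ('m \<Rightarrow>\<^sub>0 complex) \<Rightarrow> ('m \<Rightarrow>\<^sub>0 complex) set" where
  "tensor_class M x = {x + r | r. r \<in> tensor_rel M}"

definition complexify ::
    "('m, 'b) monoid_scheme \<Rightarrow> (complex, ('m \<Rightarrow>\<^sub>0 complex) set) module" where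
  "complexify M =
     \<lparr>carrier = tensor_class M ` {x. Poly_Mapping.keys x \<subseteq> carrier M},
      monoid.mult = undefined, one = undefined,
      ring.zero = tensor_rel M,
      ring.add = (\<lambda>s t. {x + y | x y. x \<in> s \<and> y \<in> t}),
      smult = (\<lambda>c t. {cscale c x + r | x r. x \<in> t \<and> r \<in> tensor_rel M})\<rparr>"

definition pure_tensor :: "('m, 'b) monoid_scheme \<Rightarrow> 'm \<Rightarrow> ('m \<Rightarrow>\<^sub>0 complex) set" where
  "pure_tensor M m = tensor_class M (Poly_Mapping.single m 1)"

text \<open>The linear map \<open>\<complex> \<otimes> M \<rightarrow> W\<close>, \<open>c \<otimes> m \<mapsto> c h(m)\<close>, induced by a homomorphism \<open>h\<close> from \<open>M\<close>
  to the additive group of the complex vector space \<open>W\<close>, evaluated on a coset by means of its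
  representatives.\<close>

definition tensor_lift ::
    "(complex, 'w) module \<Rightarrow> ('m \<Rightarrow> 'w) \<Rightarrow> ('m \<Rightarrow>\<^sub>0 complex) set \<Rightarrow> 'w" where
  "tensor_lift W h t =
     the_elem ((\<lambda>x. \<Oplus>\<^bsub>W\<^esub>m\<in>Poly_Mapping.keys x. Poly_Mapping.lookup x m \<odot>\<^bsub>W\<^esub> h m) ` t)"

definition complexify_map ::
    "('n, 'b) monoid_scheme \<Rightarrow> ('m \<Rightarrow> 'n) \<Rightarrow> ('m \<Rightarrow>\<^sub>0 complex) set \<Rightarrow> ('n \<Rightarrow>\<^sub>0 complex) set" where
  "complexify_map N h = tensor_lift (complexify N) (\<lambda>m. pure_tensor N (h m))"

text \<open>The determinant of an endomorphism of a finite-dimensional complex vector space is that of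
  its matrix with respect to any basis; for the zero space it is \<open>1\<close>.\<close>

definition endo_det :: "(complex, 'w) module \<Rightarrow> ('w \<Rightarrow> 'w) \<Rightarrow> complex" where
  "endo_det V T =
     (THE d. \<exists>bs A. distinct bs \<and> vectorspace.basis complex_field V (set bs) \<and>
        A \<in> carrier_mat (length bs) (length bs) \<and>
        (\<forall>j<length bs. T (bs ! j) = (\<Oplus>\<^bsub>V\<^esub>i\<in>{..<length bs}. A $$ (i, j) \<odot>\<^bsub>V\<^esub> (bs ! i))) \<and>
        d = Determinant.det A)"


section \<open>S-units, Artin systems and the Stark regulator\<close>

definition S_units :: "'a::field_char_0 set \<Rightarrow> 'a set \<Rightarrow> 'a place set \<Rightarrow> 'a monoid" where
  "S_units k K S = (mult_of (ring_on K))
     \<lparr>carrier := {u \<in> K - {0}. \<forall>w\<in>places K - places_above k K S. place_abs K w u = 1}\<rparr>"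

abbreviation Y_module ::
    "'a::field_char_0 set \<Rightarrow> 'a set \<Rightarrow> 'a place set \<Rightarrow> ('a place \<Rightarrow>\<^sub>0 int) monoid" where
  "Y_module k K S \<equiv> free_Abelian_group (places_above k K S)"

definition augmentation :: "('a place \<Rightarrow>\<^sub>0 int) \<Rightarrow> int" where
  "augmentation y = (\<Sum>w\<in>Poly_Mapping.keys y. Poly_Mapping.lookup y w)"

definition Y_act :: "'a set \<Rightarrow> ('a \<Rightarrow> 'a) \<Rightarrow> ('a place \<Rightarrow>\<^sub>0 int) \<Rightarrow> ('a place \<Rightarrow>\<^sub>0 int)" where
  "Y_act K \<sigma> = frag_extend (\<lambda>w. frag_of (place_act K \<sigma> w))"

text \<open>The homomorphism \<open>Y_S(K) \<rightarrow> E_S(K)\<close>, \<open>w \<mapsto> \<epsilon> w\<close>.\<close>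

definition artin_map :: "('a place \<Rightarrow> 'a::field_char_0) \<Rightarrow> ('a place \<Rightarrow>\<^sub>0 int) \<Rightarrow> 'a" where
  "artin_map \<epsilon> y = (\<Prod>w\<in>Poly_Mapping.keys y. \<epsilon> w powi Poly_Mapping.lookup y w)"

text \<open>Only the values of \<open>\<epsilon>\<close> on the places of \<open>K\<close> above \<open>S\<close> are relevant.\<close>

definition artin_system ::
    "'a::field_char_0 set \<Rightarrow> 'a set \<Rightarrow> 'a place set \<Rightarrow> ('a place \<Rightarrow> 'a) \<Rightarrow> bool" where
  "artin_system k K S \<epsilon> \<longleftrightarrow>
     (\<forall>w\<in>places_above k K S. \<epsilon> w \<in> carrier (S_units k K S)) \<and>
     (\<forall>\<sigma>\<in>carrier (galois_group k K). \<forall>y\<in>carrier (Y_module k K S).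
        artin_map \<epsilon> (Y_act K \<sigma> y) = \<sigma> (artin_map \<epsilon> y)) \<and>
     (\<exists>\<alpha>\<in>carrier (Y_module k K S).
        (\<forall>\<sigma>\<in>carrier (galois_group k K). Y_act K \<sigma> \<alpha> = \<alpha>) \<and>
        augmentation \<alpha> \<noteq> 0 \<and>
        kernel (Y_module k K S) (S_units k K S) (artin_map \<epsilon>) = range (\<lambda>n. frag_cmul n \<alpha>))"

abbreviation CE ::
    "'a::field_char_0 set \<Rightarrow> 'a set \<Rightarrow> 'a place set \<Rightarrow> (complex, ('a \<Rightarrow>\<^sub>0 complex) set) module" where
  "CE k K S \<equiv> complexify (S_units k K S)"

abbreviation CY ::
    "'a::field_char_0 set \<Rightarrow> 'a set \<Rightarrow> 'a place set
      \<Rightarrow> (complex, (('a place \<Rightarrow>\<^sub>0 int) \<Rightarrow>\<^sub>0 complex) set) module" where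
  "CY k K S \<equiv> complexify (Y_module k K S)"

text \<open>\<open>\<complex>X_S(K)\<close> is viewed as a subspace of \<open>\<complex>Y_S(K)\<close>, in which the logarithmic map takes values.\<close>

definition log_map ::
    "'a::field_char_0 set \<Rightarrow> 'a set \<Rightarrow> 'a place set
      \<Rightarrow> ('a \<Rightarrow>\<^sub>0 complex) set \<Rightarrow> (('a place \<Rightarrow>\<^sub>0 int) \<Rightarrow>\<^sub>0 complex) set" where
  "log_map k K S = tensor_lift (CY k K S)
     (\<lambda>u. \<Oplus>\<^bsub>CY k K S\<^esub>w\<in>places_above k K S.
        complex_of_real (- ln (place_abs K w u)) \<odot>\<^bsub>CY k K S\<^esub>
          pure_tensor (Y_module k K S) (frag_of w))"

definition CE_act ::
    "'a::field_char_0 set \<Rightarrow> 'a set \<Rightarrow> 'a place set \<Rightarrow> (('a \<Rightarrow> 'a) \<Rightarrow> complex)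
      \<Rightarrow> ('a \<Rightarrow>\<^sub>0 complex) set \<Rightarrow> ('a \<Rightarrow>\<^sub>0 complex) set" where
  "CE_act k K S a t =
     (\<Oplus>\<^bsub>CE k K S\<^esub>\<sigma>\<in>carrier (galois_group k K).
        a \<sigma> \<odot>\<^bsub>CE k K S\<^esub> complexify_map (S_units k K S) \<sigma> t)"

definition CE_part ::
    "'a::field_char_0 set \<Rightarrow> 'a set \<Rightarrow> 'a place set \<Rightarrow> (('a \<Rightarrow> 'a) \<Rightarrow> complex)
      \<Rightarrow> (complex, ('a \<Rightarrow>\<^sub>0 complex) set) module" where
  "CE_part k K S \<psi> = (CE k K S)
     \<lparr>carrier := CE_act k K S (char_idempotent (galois_group k K) \<psi>) ` carrier (CE k K S)\<rparr>"

definition stark_regulator ::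
    "'a::field_char_0 set \<Rightarrow> 'a set \<Rightarrow> 'a place set \<Rightarrow> ('a place \<Rightarrow> 'a)
      \<Rightarrow> (('a \<Rightarrow> 'a) \<Rightarrow> complex) \<Rightarrow> complex" where
  "stark_regulator k K S \<epsilon> \<psi> =
     endo_det (CE_part k K S (conj_char (galois_group k K) \<psi>))
       (complexify_map (S_units k K S) (artin_map \<epsilon>) \<circ> log_map k K S)"

definition stark_quotient ::
    "'a::field_char_0 set \<Rightarrow> 'a set \<Rightarrow> 'a place set \<Rightarrow> ('a place \<Rightarrow> 'a)
      \<Rightarrow> (('a \<Rightarrow> 'a) \<Rightarrow> complex) \<Rightarrow> complex" where
  "stark_quotient k K S \<epsilon> \<psi> = L_leading_coeff k K S \<psi> / stark_regulator k K S \<epsilon> \<psi>"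

definition stark_element ::
    "'a::field_char_0 set \<Rightarrow> 'a set \<Rightarrow> 'a place set \<Rightarrow> ('a place \<Rightarrow> 'a) \<Rightarrow> ('a \<Rightarrow> 'a) \<Rightarrow> complex" where
  "stark_element k K S \<epsilon> =
     (\<lambda>\<sigma>. \<Sum>\<psi>\<in>characters (galois_group k K).
        stark_quotient k K S \<epsilon> \<psi> *
          char_idempotent (galois_group k K) (conj_char (galois_group k K) \<psi>) \<sigma>)"

end

theory Submission
  imports Defs "HOL-Computational_Algebra.Fundamental_Theorem_Algebra"
begin

text \<open>The coefficient of \<open>\<beta>\<close> at \<open>\<sigma>\<close> is \<open>|G|\<^sup>-\<^sup>1 \<Sum>\<^sub>\<psi> A(\<psi>) \<psi>(\<sigma>)\<close>. If
  \<open>A\<close> is Galois equivariant, then \<open>g\<close> merely permutes the summands, so the coefficient is fixed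
  by all \<open>g\<close> and hence rational. Conversely, \<open>A(\<psi>) = \<Sum>\<^sub>\<sigma> \<beta>(\<sigma>) \<psi>(\<sigma>\<^sup>-\<^sup>1)\<close> expresses \<open>A(\<psi>)\<close> through
  roots of unity with rational coefficients, on which \<open>g\<close> acts as it acts on \<open>\<psi>\<close>. That only
  rational numbers are fixed by all \<open>g\<close> follows by mapping an irrational algebraic number to
  another root of its minimal polynomial and extending this to all algebraic numbers by Zorn's lemma.\<close>

hide_const (open) up_ring.coeff up_ring.monom

section \<open>Algebraic numbers\<close>

text \<open>Viewing the ambient field as a rational vector space makes the span used in
  \<open>number_field\<close> available as \<open>rat_vs.span\<close>.\<close>

global_interpretation rat_vs: vector_space "\<lambda>(q::rat) (x::'a::field_char_0). of_rat q * x"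
  by unfold_locales (simp_all add: algebra_simps of_rat_add of_rat_mult)

text \<open>Infinitely many distinct powers in a finite-dimensional rational space are linearly
  dependent, and a dependency is a polynomial equation for \<open>x\<close>. If two powers coincide,
  their difference already gives such an equation.\<close>

lemma algebraic_if_powers_in_finite_span:
  fixes x :: "'a::field_char_0"
  assumes "finite B" and powers: "\<And>i. x ^ i \<in> rat_vs.span B"
  shows "algebraic x"
proof (cases "inj (\<lambda>i::nat. x ^ i)")
  case False
  then obtain i j :: nat where ij: "i \<noteq> j" "x ^ i = x ^ j"
    by (auto simp: inj_on_def)
  define p :: "'a poly" where "p = monom 1 i - monom 1 j"
  show ?thesis
  proof (rule algebraicI)
    show "p \<noteq> 0" using ij by (auto simp: p_def monom_eq_iff')
    show "poly p x = 0" using ij by (simp add: p_def poly_monom)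
  qed (simp add: p_def coeff_monom)
next
  case True
  let ?P = "range (\<lambda>i::nat. x ^ i)"
  have "infinite ?P" using True by (simp add: finite_image_iff)
  then have "rat_vs.dependent ?P"
    using rat_vs.independent_span_bound[OF \<open>finite B\<close>, of ?P] powers by blast
  then obtain t u where tu: "finite t" "t \<subseteq> ?P" "(\<Sum>v\<in>t. of_rat (u v) * v) = 0" "\<exists>v\<in>t. u v \<noteq> 0"
    unfolding rat_vs.dependent_explicit by blast
  obtain I where I: "finite I" "t = (\<lambda>i. x ^ i) ` I"
    using tu(1,2) by (meson finite_subset_image)
  \<comment> \<open>The dependency \<open>u\<close> is indexed by the values \<open>x ^ i\<close>;
    injectivity turns it into coefficients indexed by exponents.\<close>
  define p :: "'a poly" where "p = (\<Sum>i\<in>I. monom (of_rat (u (x ^ i))) i)"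
  have coeff: "coeff p n = (if n \<in> I then of_rat (u (x ^ n)) else 0)" for n
    using I(1) by (simp add: p_def coeff_sum coeff_monom sum.delta')
  show ?thesis
  proof (rule algebraicI')
    show "coeff p n \<in> \<rat>" for n by (simp add: coeff)
    show "p \<noteq> 0"
      using tu(4) I(2) coeff by (metis (no_types, lifting) coeff_0 imageE of_rat_eq_0_iff)
    show "poly p x = 0"
      using tu(3) True I(2)
      by (simp add: p_def poly_sum poly_monom sum.reindex inj_on_subset[OF True])
  qed
qed

lemma degree_nonzero_if_root: "p \<noteq> 0 \<Longrightarrow> poly p x = 0 \<Longrightarrow> degree p \<noteq> 0"
  by (cases "degree p = 0") (auto elim!: degree_eq_zeroE)

text \<open>Solving \<open>poly p x = 0\<close> for the leading term puts \<open>x ^ n\<close>,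
  \<open>n = degree p\<close>, into the span of the lower powers. That span is then stable under
  multiplication by \<open>x\<close>.\<close>

lemma power_in_span_of_small_powers:
  fixes x :: "'a::field_char_0"
  assumes "algebraic x"
  obtains n where "\<And>k. x ^ k \<in> rat_vs.span ((\<lambda>i. x ^ i) ` {..<n})"
proof -
  obtain p where p: "\<And>i. coeff p i \<in> \<int>" "p \<noteq> 0" "poly p x = 0"
    using assms by (erule algebraicE)
  define n where "n = degree p"
  let ?V = "rat_vs.span ((\<lambda>i. x ^ i) ` {..<n})"
  have scale: "q * v \<in> ?V" if "q \<in> \<rat>" "v \<in> ?V" for q v
    using that rat_vs.span_scale by (auto simp: Rats_def)
  have "lead_coeff p * x ^ n = - (\<Sum>i<n. coeff p i * x ^ i)"
    using p(3) by (simp add: poly_altdef n_def lessThan_Suc_atMost[symmetric] eq_neg_iff_add_eq_0 add.commute)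
  then have "x ^ n = inverse (lead_coeff p) * - (\<Sum>i<n. coeff p i * x ^ i)"
    using p(2) by (simp add: field_simps)
  also have "\<dots> \<in> ?V"
    by (intro scale rat_vs.span_neg rat_vs.span_sum rat_vs.span_base Rats_inverse)
       (use p(1) Ints_subset_Rats in auto)
  finally have n: "x ^ n \<in> ?V" .
  have mult: "x * v \<in> ?V" if "v \<in> ?V" for v
    using that
  proof (induction rule: rat_vs.span_induct_alt)
    case (step c y z)
    then obtain i where "i < n" "y = x ^ i" by auto
    have "x ^ Suc i \<in> ?V"
    proof (cases "Suc i = n")
      case False
      then show ?thesis using \<open>i < n\<close> by (intro rat_vs.span_base imageI) simp
    qed (use n in simp)
    then have "x * y \<in> ?V"
      by (simp add: \<open>y = x ^ i\<close>)
    then show ?case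
      using rat_vs.span_add[OF rat_vs.span_scale[of "x * y" _ c] step(2)] by (simp add: algebra_simps)
  qed (simp add: rat_vs.span_zero)
  \<comment> \<open>For \<open>n = 0\<close> there would be no generators, not even
    \<open>x ^ 0 = 1\<close>, where the induction starts.\<close>
  have "n \<noteq> 0"
    using p(2,3) unfolding n_def by (rule degree_nonzero_if_root)
  have "x ^ k \<in> ?V" for k
  proof (induction k)
    case 0
    show ?case using \<open>n \<noteq> 0\<close> by (intro rat_vs.span_base) force
  qed (simp add: mult)
  then show thesis by (rule that)
qed

lemma mult_in_span_products:
  fixes A B :: "'a::field_char_0 set"
  assumes "x \<in> rat_vs.span A" and "y \<in> rat_vs.span B"
  shows "x * y \<in> rat_vs.span ((\<lambda>(a, b). a * b) ` (A \<times> B))" (is "_ \<in> ?V")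
  using assms(1)
proof (induction rule: rat_vs.span_induct_alt)
  case (step c a x)
  have "a * y \<in> ?V"
    using assms(2)
  proof (induction rule: rat_vs.span_induct_alt)
    case (step d b y)
    have "a * b \<in> ?V" using \<open>a \<in> A\<close> step(1) by (intro rat_vs.span_base) force
    then show ?case
      using rat_vs.span_add[OF rat_vs.span_scale[of "a * b" _ d] step(2)] by (simp add: algebra_simps)
  qed (simp add: rat_vs.span_zero)
  then show ?case
    using rat_vs.span_add[OF rat_vs.span_scale[of "a * y" _ c] step(2)] by (simp add: algebra_simps)
qed (simp add: rat_vs.span_zero)

text \<open>All \<open>x ^ i * y ^ j\<close> lie in the span of the finitely many products of small
  powers. Powers of the product are of this form, and powers of the sum are combinations of them by
  the binomial theorem.\<close>

lemma
  fixes x y :: "'a::field_char_0"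
  assumes "algebraic x" and "algebraic y"
  shows algebraic_plus: "algebraic (x + y)" and algebraic_times: "algebraic (x * y)"
proof -
  obtain m where m: "\<And>k. x ^ k \<in> rat_vs.span ((\<lambda>i. x ^ i) ` {..<m})"
    using power_in_span_of_small_powers[OF assms(1)] by blast
  obtain n where n: "\<And>k. y ^ k \<in> rat_vs.span ((\<lambda>i. y ^ i) ` {..<n})"
    using power_in_span_of_small_powers[OF assms(2)] by blast
  define B where "B = (\<lambda>(a, b). a * b) ` (((\<lambda>i. x ^ i) ` {..<m}) \<times> ((\<lambda>i. y ^ i) ` {..<n}))"
  have "finite B" by (simp add: B_def)
  have prod: "x ^ i * y ^ j \<in> rat_vs.span B" for i j
    unfolding B_def by (rule mult_in_span_products[OF m n])
  show "algebraic (x * y)"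
    by (rule algebraic_if_powers_in_finite_span[OF \<open>finite B\<close>]) (simp add: power_mult_distrib prod)
  have "of_nat c * v \<in> rat_vs.span B" if "v \<in> rat_vs.span B" for c v
    using rat_vs.span_scale[OF that, of "of_nat c"] by simp
  then show "algebraic (x + y)"
    by (intro algebraic_if_powers_in_finite_span[OF \<open>finite B\<close>])
       (auto simp: binomial_ring mult.assoc intro!: rat_vs.span_sum prod)
qed

lemma algebraic_sum:
  "(\<And>i. i \<in> I \<Longrightarrow> algebraic (f i)) \<Longrightarrow> algebraic (sum f I)" for f :: "_ \<Rightarrow> 'a::field_char_0"
  by (induction I rule: infinite_finite_induct) (auto intro: algebraic_plus)

lemma algebraic_power: "algebraic x \<Longrightarrow> algebraic (x ^ n)" for x :: "'a::field_char_0"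
  by (induction n) (auto intro: algebraic_times)

section \<open>The fixed field of the absolute Galois group\<close>

text \<open>A partial automorphism of the algebraic numbers is encoded by its graph, a subring of
  \<open>\<complex> \<times> \<complex>\<close>. Since all \<open>x\<close> are algebraic, injectivity and the algebraicity of the values
  follow, so the notion is symmetric: extending the converse graph enlarges the range.\<close>

definition partial_iso :: "(complex \<times> complex) set \<Rightarrow> bool" where
  "partial_iso R \<longleftrightarrow>
     (\<forall>q\<in>\<rat>. (q, q) \<in> R) \<and>
     (\<forall>(x, y)\<in>R. \<forall>(x', y')\<in>R. (x - x', y - y') \<in> R \<and> (x * x', y * y') \<in> R) \<and>
     (\<forall>(x, y)\<in>R. algebraic x) \<and>
     (\<forall>y. (0, y) \<in> R \<longrightarrow> y = 0)"

definition coeffs_related :: "('a::zero \<times> 'b::zero) set \<Rightarrow> 'a poly \<Rightarrow> 'b poly \<Rightarrow> bool" where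
  "coeffs_related R p q \<longleftrightarrow> (\<forall>i. (coeff p i, coeff q i) \<in> R)"

text \<open>\<open>m\<close> is, up to a scalar, the minimal polynomial of \<open>a\<close> over the domain of \<open>R\<close>, and \<open>m'\<close>
  its image under the isomorphism \<open>R\<close>.\<close>

definition minimal_poly_pair ::
    "(complex \<times> complex) set \<Rightarrow> complex \<Rightarrow> complex poly \<Rightarrow> complex poly \<Rightarrow> bool" where
  "minimal_poly_pair R a m m' \<longleftrightarrow>
     coeffs_related R m m' \<and> m \<noteq> 0 \<and> poly m a = 0 \<and>
     (\<forall>p q. coeffs_related R p q \<longrightarrow> p \<noteq> 0 \<longrightarrow> poly p a = 0 \<longrightarrow> degree m \<le> degree p)"

lemma minimal_poly_pairD:
  assumes "minimal_poly_pair R a m m'"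
  shows "coeffs_related R m m'" "m \<noteq> 0" "poly m a = 0"
    and "coeffs_related R p q \<Longrightarrow> p \<noteq> 0 \<Longrightarrow> poly p a = 0 \<Longrightarrow> degree m \<le> degree p"
  using assms by (auto simp: minimal_poly_pair_def)

section \<open>Arithmetic of partial isomorphisms and adjunction of one algebraic number\<close>

context
  fixes R :: "(complex \<times> complex) set"
  assumes R: "partial_iso R"
begin

lemma partial_iso_rat: "q \<in> \<rat> \<Longrightarrow> (q, q) \<in> R"
  using R by (simp add: partial_iso_def)

lemma partial_iso_diff: "(x, y) \<in> R \<Longrightarrow> (x', y') \<in> R \<Longrightarrow> (x - x', y - y') \<in> R"
  using R unfolding partial_iso_def by blast

lemma partial_iso_mult: "(x, y) \<in> R \<Longrightarrow> (x', y') \<in> R \<Longrightarrow> (x * x', y * y') \<in> R"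
  using R unfolding partial_iso_def by blast

lemma partial_iso_algebraic: "(x, y) \<in> R \<Longrightarrow> algebraic x"
  using R unfolding partial_iso_def by blast

lemma partial_iso_zero_left: "(0, y) \<in> R \<Longrightarrow> y = 0"
  using R by (simp add: partial_iso_def)

lemma partial_iso_add: "(x, y) \<in> R \<Longrightarrow> (x', y') \<in> R \<Longrightarrow> (x + x', y + y') \<in> R"
  using partial_iso_diff[OF _ partial_iso_diff[OF partial_iso_rat[of 0]], of x y x' y'] by simp

lemma partial_iso_sum: "(\<And>i. i \<in> I \<Longrightarrow> (f i, g i) \<in> R) \<Longrightarrow> (sum f I, sum g I) \<in> R"
  by (induction I rule: infinite_finite_induct) (auto intro: partial_iso_add partial_iso_rat)

lemma partial_iso_poly:
  assumes "coeffs_related R p q" and "(x, y) \<in> R"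
  shows "(poly p x, poly q y) \<in> R"
  using assms(1)
proof (induction p arbitrary: q)
  case 0
  then have "coeff q i = 0" for i
    by (auto simp: coeffs_related_def intro: partial_iso_zero_left)
  then have "q = 0" by (simp add: poly_eq_iff)
  then show ?case by (simp add: partial_iso_rat)
next
  case (pCons a p)
  obtain b q' where q: "q = pCons b q'" by (cases q)
  have "(a, b) \<in> R" "coeffs_related R p q'"
    using pCons.prems unfolding coeffs_related_def q by (metis coeff_pCons_0, metis coeff_pCons_Suc)
  then show ?case
    using pCons.IH assms(2) by (auto simp: q intro: partial_iso_add partial_iso_mult)
qed

lemma coeffs_related_rat: "(\<And>i. coeff p i \<in> \<rat>) \<Longrightarrow> coeffs_related R p p"
  by (simp add: coeffs_related_def partial_iso_rat)

text \<open>A nonzero algebraic \<open>x\<close> is a root of an integer polynomial with nonzero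
  constant term. Evaluating it at both entries of \<open>(x, 0)\<close> would relate 0 to that
  constant term.\<close>

lemma partial_iso_zero_right:
  assumes "(x, 0) \<in> R"
  shows "x = 0"
proof (rule ccontr)
  assume "x \<noteq> 0"
  obtain p where p: "coeff p 0 \<noteq> 0" "poly (map_poly of_int p) x = 0"
    using algebraicE'_nonzero[OF partial_iso_algebraic[OF assms] \<open>x \<noteq> 0\<close>] by blast
  have "(poly (map_poly of_int p) x, poly (map_poly of_int p) 0) \<in> R"
    by (rule partial_iso_poly[OF coeffs_related_rat assms]) (simp add: coeff_map_poly)
  then have "poly (map_poly of_int p) 0 = (0::complex)"
    using p(2) partial_iso_zero_left by simp
  then show False
    using p(1) by (simp add: poly_0_coeff_0 coeff_map_poly)
qed

lemma partial_iso_zero_iff: "(x, y) \<in> R \<Longrightarrow> x = 0 \<longleftrightarrow> y = 0"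
  using partial_iso_zero_left partial_iso_zero_right by blast

lemma partial_iso_left_unique: "(x, y) \<in> R \<Longrightarrow> (x, y') \<in> R \<Longrightarrow> y = y'"
  using partial_iso_zero_left[of "y - y'"] partial_iso_diff[of x y x y'] by simp

text \<open>An integer polynomial is related to itself, so every root on the left is carried to a
  root of the same polynomial.\<close>

lemma partial_iso_algebraic_right:
  assumes "(x, y) \<in> R"
  shows "algebraic y"
proof -
  obtain p where p: "\<And>i. coeff p i \<in> \<int>" "p \<noteq> 0" "poly p x = 0"
    using partial_iso_algebraic[OF assms] by (erule algebraicE)
  have "coeffs_related R p p"
    using p(1) Ints_subset_Rats by (intro coeffs_related_rat) auto
  then have "poly p y = 0"
    using partial_iso_poly[OF _ assms] partial_iso_zero_left p(3) by metis
  then show ?thesis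
    using p by (intro algebraicI)
qed

lemma partial_iso_converse: "partial_iso (R\<inverse>)"
  unfolding partial_iso_def
  by (auto intro: partial_iso_rat partial_iso_diff partial_iso_mult
      partial_iso_algebraic_right partial_iso_zero_right)

lemma coeffs_related_diff:
  "coeffs_related R p q \<Longrightarrow> coeffs_related R p' q' \<Longrightarrow> coeffs_related R (p - p') (q - q')"
  by (simp add: coeffs_related_def partial_iso_diff)

lemma coeffs_related_mult:
  "coeffs_related R p q \<Longrightarrow> coeffs_related R p' q' \<Longrightarrow> coeffs_related R (p * p') (q * q')"
  by (simp add: coeffs_related_def coeff_mult partial_iso_sum partial_iso_mult)

lemma coeffs_related_monom: "(x, y) \<in> R \<Longrightarrow> coeffs_related R (monom x n) (monom y n)"
  by (simp add: coeffs_related_def coeff_monom partial_iso_rat)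

lemma coeffs_related_degree: "coeffs_related R p q \<Longrightarrow> degree p = degree q"
  unfolding coeffs_related_def Polynomial.degree_def using partial_iso_zero_iff by metis

text \<open>This makes the assignment of \<open>b\<close> to \<open>a\<close> well defined. One step
  of pseudo-division by \<open>m\<close> lowers the degree of \<open>p\<close> and keeps the root
  \<open>a\<close>; the parallel step on \<open>q\<close> by \<open>m'\<close> keeps the
  coefficients related. Scaling by the leading coefficient of \<open>m\<close> replaces division, so
  ring operations suffice.\<close>

lemma minimal_polynomial_transfer:
  assumes pair: "minimal_poly_pair R a m m'" and root': "poly m' b = 0"
  shows "coeffs_related R p q \<Longrightarrow> poly p a = 0 \<Longrightarrow> poly q b = 0"
proof (induction "degree p" arbitrary: p q rule: less_induct)
  case less
  note m = minimal_poly_pairD(1-3)[OF pair] and minimal = minimal_poly_pairD(4)[OF pair]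
  have deg: "degree p = degree q" "degree m = degree m'"
    using less.prems(1) m(1) coeffs_related_degree by blast+
  have leads: "(lead_coeff m, lead_coeff m') \<in> R" "(lead_coeff p, lead_coeff q) \<in> R"
    using less.prems(1) m(1) deg by (simp_all add: coeffs_related_def)
  show ?case
  proof (cases "p = 0")
    case True
    have "lead_coeff q = 0"
      by (rule partial_iso_zero_left) (use leads(2) True in simp)
    then show ?thesis by simp
  next
    case False
    then have "degree m \<le> degree p" using minimal less.prems by blast
    define d where "d = degree p - degree m"
    define r where "r = Polynomial.smult (lead_coeff m) p - monom (lead_coeff p) d * m"
    define r' where "r' = Polynomial.smult (lead_coeff m') q - monom (lead_coeff q) d * m'"
    have related: "coeffs_related R r r'"
      unfolding r_def r'_def
      using coeffs_related_mult[OF coeffs_related_monom[OF leads(1), of 0] less.prems(1)]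
        coeffs_related_mult[OF coeffs_related_monom[OF leads(2), of d] m(1)]
      by (intro coeffs_related_diff) (simp_all add: monom_0)
    have root: "poly r a = 0"
      using less.prems(2) m(3) by (simp add: r_def)
    have "poly r' b = 0"
    \<comment> \<open>Cancelling the leading term lowers the degree only if it is positive; the
      other case is void, as a nonzero constant has no root.\<close>
    proof (cases "degree p = 0")
      case True
      then have "p = 0" using less.prems(2) degree_nonzero_if_root by blast
      with False show ?thesis by simp
    next
      case False
      have "degree r < degree p"
      proof (rule degree_lessI)
        show "r \<noteq> 0 \<or> degree p > 0" using False by simp
        have deg_le: "degree (Polynomial.smult (lead_coeff m) p) \<le> degree p"
          "degree (monom (lead_coeff p) d * m) \<le> degree p"
          using degree_mult_le[of "monom (lead_coeff p) d" m] degree_monom_le[of "lead_coeff p" d]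
            \<open>degree m \<le> degree p\<close> by (auto simp: d_def)
        show "\<forall>k\<ge>degree p. coeff r k = 0"
        proof (intro allI impI)
          fix k assume "degree p \<le> k"
          then consider "k = degree p" | "degree p < k" by linarith
          then show "coeff r k = 0"
          proof cases
            case 1
            then show ?thesis
              using \<open>degree m \<le> degree p\<close> by (simp add: r_def d_def coeff_monom_mult)
          next
            case 2
            then show ?thesis
              using deg_le by (simp add: r_def coeff_eq_0)
          qed
        qed
      qed
      then show ?thesis using less.hyps[OF _ related root] by blast
    qed
    \<comment> \<open>At \<open>b\<close> the subtracted multiple of \<open>m'\<close> vanishes,
      leaving only the scaled \<open>q\<close>.\<close>
    then have "lead_coeff m' * poly q b = 0"
      using root' by (simp add: r'_def)
    moreover have "lead_coeff m' \<noteq> 0"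
      using leads(1) m(2) partial_iso_zero_right by (metis leading_coeff_0_iff)
    ultimately show ?thesis by simp
  qed
qed

text \<open>The extension is the graph obtained by evaluating related polynomials at
  \<open>a\<close> and \<open>b\<close>. Its only delicate property, that 0 is related to 0 alone,
  is \<open>minimal_polynomial_transfer\<close>.\<close>

lemma partial_iso_adjoin:
  assumes pair: "minimal_poly_pair R a m m'" and root': "poly m' b = 0" and "algebraic a"
  obtains R' where "partial_iso R'" "R \<subseteq> R'" "(a, b) \<in> R'"
proof -
  define R' where "R' = {(poly p a, poly q b) | p q. coeffs_related R p q}"
  have R'I: "(poly p a, poly q b) \<in> R'" if "coeffs_related R p q" for p q
    using that unfolding R'_def by blast
  have R'E: "\<exists>p q. x = poly p a \<and> y = poly q b \<and> coeffs_related R p q" if "(x, y) \<in> R'" for x y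
    using that unfolding R'_def by blast
  have const: "(x, y) \<in> R'" if "(x, y) \<in> R" for x y
    using R'I[OF coeffs_related_monom[OF that, of 0]] by (simp add: monom_0)
  have ring: "(x - x', y - y') \<in> R' \<and> (x * x', y * y') \<in> R'"
    if xy: "(x, y) \<in> R'" "(x', y') \<in> R'" for x y x' y'
  proof -
    obtain p q p' q' where pq: "x = poly p a" "y = poly q b" "x' = poly p' a" "y' = poly q' b"
      "coeffs_related R p q" "coeffs_related R p' q'"
      using R'E[OF xy(1)] R'E[OF xy(2)] by blast
    show ?thesis
      using R'I[OF coeffs_related_diff[OF pq(5,6)]] R'I[OF coeffs_related_mult[OF pq(5,6)]]
      by (simp add: pq(1-4))
  qed
  have alg: "algebraic x" if xy: "(x, y) \<in> R'" for x y
  proof -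
    obtain p q where pq: "x = poly p a" "coeffs_related R p q"
      using R'E[OF xy] by blast
    then have "algebraic (coeff p i)" for i
      using partial_iso_algebraic unfolding coeffs_related_def by blast
    then show ?thesis
      unfolding pq(1) poly_altdef
      by (intro algebraic_sum algebraic_times algebraic_power \<open>algebraic a\<close>)
  qed
  have zero: "y = 0" if y: "(0, y) \<in> R'" for y
    using R'E[OF y] minimal_polynomial_transfer[OF pair root'] by metis
  have "partial_iso R'"
    unfolding partial_iso_def using ring alg zero const[OF partial_iso_rat] by blast
  moreover have "R \<subseteq> R'" using const by auto
  moreover have "coeffs_related R (monom 1 1) (monom 1 1)"
    by (intro coeffs_related_monom partial_iso_rat) simp
  then have "(a, b) \<in> R'" using R'I[of "monom 1 1" "monom 1 1"] by (simp add: poly_monom)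
  ultimately show thesis by (rule that)
qed

lemma minimal_polynomial_exists:
  assumes "algebraic a"
  obtains m m' where "minimal_poly_pair R a m m'"
proof -
  obtain p where p: "\<And>i. coeff p i \<in> \<int>" "p \<noteq> 0" "poly p a = 0"
    using assms by (erule algebraicE)
  let ?P = "\<lambda>m. (\<exists>m'. coeffs_related R m m') \<and> m \<noteq> 0 \<and> poly m a = 0"
  have "coeffs_related R p p"
    using p(1) Ints_subset_Rats by (intro coeffs_related_rat) auto
  then have "?P p" using p by blast
  from ex_has_least_nat[of ?P, OF this, of degree]
  obtain m where "?P m" "\<forall>p. ?P p \<longrightarrow> degree m \<le> degree p" by blast
  then show thesis using that unfolding minimal_poly_pair_def by blast
qed

text \<open>Related polynomials have equal degrees, so \<open>m'\<close> is nonconstant like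
  \<open>m\<close>, and any of its complex roots may serve as the image of \<open>a\<close>.\<close>

lemma partial_iso_extend:
  assumes "algebraic a"
  obtains R' b where "partial_iso R'" "R \<subseteq> R'" "(a, b) \<in> R'"
proof -
  obtain m m' where pair: "minimal_poly_pair R a m m'"
    using minimal_polynomial_exists[OF assms] by blast
  note m = minimal_poly_pairD(1-3)[OF pair]
  have "degree m \<noteq> 0" using m(2,3) by (rule degree_nonzero_if_root)
  then have "degree m' \<noteq> 0" using coeffs_related_degree[OF m(1)] by simp
  then obtain b where "poly m' b = 0"
    using alg_closed_imp_poly_has_root[of m'] by auto
  then show thesis
    using partial_iso_adjoin[OF pair _ assms, of b] that by metis
qed

end

text \<open>Each closure condition involves at most two pairs, and two pairs from the members of a
  chain lie in a common member.\<close>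

lemma partial_iso_Union:
  assumes "C \<noteq> {}" and chain: "subset.chain (Collect partial_iso) C"
  shows "partial_iso (\<Union>C)"
proof -
  have C: "partial_iso X" if "X \<in> C" for X
    using chain that by (auto simp: subset_chain_def)
  have "\<exists>X\<in>C. u \<in> X \<and> v \<in> X" if "u \<in> \<Union>C" "v \<in> \<Union>C" for u v
  proof -
    obtain X Y where XY: "X \<in> C" "Y \<in> C" "u \<in> X" "v \<in> Y" using \<open>u \<in> \<Union>C\<close> \<open>v \<in> \<Union>C\<close> by auto
    then have "X \<subseteq> Y \<or> Y \<subseteq> X" using chain by (simp add: subset_chain_def)
    then show ?thesis using XY by auto
  qed
  then have ring: "(x - x', y - y') \<in> \<Union>C \<and> (x * x', y * y') \<in> \<Union>C"
    if "(x, y) \<in> \<Union>C" "(x', y') \<in> \<Union>C" for x y x' y'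
    using that C partial_iso_diff partial_iso_mult by (meson UnionI)
  have rat: "(q, q) \<in> \<Union>C" if "q \<in> \<rat>" for q
    using \<open>C \<noteq> {}\<close> C partial_iso_rat that by auto
  have alg: "algebraic x" if "(x, y) \<in> \<Union>C" for x y
    using that C partial_iso_algebraic by auto
  have zero: "y = 0" if "(0, y) \<in> \<Union>C" for y
    using that C partial_iso_zero_left by auto
  show ?thesis
    unfolding partial_iso_def using ring rat alg zero by fast
qed

text \<open>Zorn's lemma gives a maximal extension \<open>M\<close>. An algebraic number missing
  from the domain of \<open>M\<close>, or from that of its converse, could be adjoined there,
  against maximality.\<close>

lemma partial_iso_extend_total:
  assumes "partial_iso R"
  obtains M where "partial_iso M" "R \<subseteq> M" "Domain M = {z. algebraic z}" "Range M = {z. algebraic z}"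
proof -
  let ?A = "{M. partial_iso M \<and> R \<subseteq> M}"
  have "\<exists>M\<in>?A. \<forall>X\<in>?A. M \<subseteq> X \<longrightarrow> X = M"
  proof (rule subset_Zorn_nonempty)
    fix C assume C: "C \<noteq> {}" "subset.chain ?A C"
    from C(2) have "subset.chain (Collect partial_iso) C" by (simp add: subset_chain_def subset_iff)
    moreover have "R \<subseteq> \<Union>C"
    proof -
      obtain X where "X \<in> C" using C(1) by auto
      then have "R \<subseteq> X" using C(2) by (auto simp: subset_chain_def)
      then show ?thesis using \<open>X \<in> C\<close> by auto
    qed
    ultimately show "\<Union>C \<in> ?A" using partial_iso_Union[OF C(1)] by simp
  qed (use assms in auto)
  then obtain M where "M \<in> ?A" and M_max: "\<forall>X\<in>?A. M \<subseteq> X \<longrightarrow> X = M" ..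
  then have M: "partial_iso M" "R \<subseteq> M" by auto
  have maximal: "X = M" if "partial_iso X" "M \<subseteq> X" for X
    using M_max M(2) that by simp
  have "a \<in> Domain M" if a: "algebraic a" for a
  proof -
    obtain X b where "partial_iso X" "M \<subseteq> X" "(a, b) \<in> X"
      using partial_iso_extend[OF M(1) a] by blast
    then show ?thesis using maximal by blast
  qed
  moreover have "a \<in> Range M" if a: "algebraic a" for a
  proof -
    obtain X b where X: "partial_iso X" "M\<inverse> \<subseteq> X" "(a, b) \<in> X"
      using partial_iso_extend[OF partial_iso_converse[OF M(1)] a] by blast
    have "X\<inverse> = M"
      using X(2) by (intro maximal partial_iso_converse[OF X(1)]) auto
    then show ?thesis using X(3) by auto
  qed
  ultimately have "Domain M = {z. algebraic z}" "Range M = {z. algebraic z}"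
    by (auto dest: partial_iso_algebraic[OF M(1)] partial_iso_algebraic_right[OF M(1)])
  with M show thesis by (rule that)
qed

lemma partial_iso_Rats: "partial_iso {(q, q) | q. q \<in> \<rat>}"
  unfolding partial_iso_def by (auto intro: rat_imp_algebraic)

text \<open>Over the diagonal of the rationals, \<open>m\<close> is the minimal polynomial of
  \<open>z\<close> up to a scalar. It has degree at least 2 and \<open>z\<close> as a simple root,
  so its cofactor \<open>h\<close> has a root \<open>b\<close> different from
  \<open>z\<close>.\<close>

lemma partial_iso_move_irrational:
  assumes "algebraic z" and "z \<notin> \<rat>"
  obtains R b where "partial_iso R" "(z, b) \<in> R" "b \<noteq> z"
proof -
  let ?Q = "{(q, q) | q::complex. q \<in> \<rat>}"
  have related_iff: "coeffs_related ?Q p q \<longleftrightarrow> p = q \<and> (\<forall>i. coeff p i \<in> \<rat>)" for p q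
    by (auto simp: coeffs_related_def poly_eq_iff)
  obtain m m' where pair: "minimal_poly_pair ?Q z m m'"
    using minimal_polynomial_exists[OF partial_iso_Rats assms(1)] by blast
  note m = minimal_poly_pairD(1-3)[OF pair] and minimal = minimal_poly_pairD(4)[OF pair]
  have m': "m' = m" and rat: "\<And>i. coeff m i \<in> \<rat>"
    using related_iff[THEN iffD1, OF m(1)] by auto
  obtain h where h: "m = [:- z, 1:] * h"
    using m(3) by (auto simp: poly_eq_0_iff_dvd)
  have "h \<noteq> 0" using m(2) h by auto
  have deg_m: "degree m = Suc (degree h)"
    unfolding h using \<open>h \<noteq> 0\<close> by (subst degree_mult_eq) auto
  \<comment> \<open>Otherwise \<open>m\<close> would be linear with rational coefficients, making
    \<open>z\<close> rational.\<close>
  have "degree h \<noteq> 0"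
  proof
    assume "degree h = 0"
    then obtain c where "h = [:c:]" by (rule degree_eq_zeroE)
    then have "m = [:- z * c, c:]" "c \<noteq> 0" using h \<open>h \<noteq> 0\<close> by auto
    then have "- z * c \<in> \<rat>" "c \<in> \<rat>"
      using rat[of 0] rat[of 1] by auto
    then have "- z * c / c \<in> \<rat>" by (rule Rats_divide)
    then show False using \<open>c \<noteq> 0\<close> assms(2) by simp
  qed
  then obtain b where b: "poly h b = 0"
    using alg_closed_imp_poly_has_root[of h] by auto
  \<comment> \<open>At a double root the derivative of \<open>m\<close> would vanish too, a nonzero
    rational polynomial of smaller degree.\<close>
  have "poly h z \<noteq> 0"
  proof
    assume "poly h z = 0"
    then have "poly (pderiv m) z = 0"
      unfolding h pderiv_mult by (simp add: pderiv_pCons del: mult_pCons_left)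
    moreover have "coeffs_related ?Q (pderiv m) (pderiv m)"
      using rat by (auto simp: related_iff coeff_pderiv)
    moreover have "pderiv m \<noteq> 0" "degree (pderiv m) < degree m"
      using deg_m by (simp_all add: pderiv_eq_0_iff degree_pderiv)
    ultimately show False using minimal by fastforce
  qed
  then have "b \<noteq> z" using b by auto
  have "poly m b = 0" using b by (simp add: h)
  then have "poly m' b = 0" by (simp add: m')
  then obtain R' where "partial_iso R'" "(z, b) \<in> R'"
    using partial_iso_adjoin[OF partial_iso_Rats pair _ assms(1)] by metis
  then show thesis using \<open>b \<noteq> z\<close> by (rule that)
qed


section \<open>Galois group elements as automorphisms, and the rationals as fixed field\<close>

lemma galois_groupD:
  assumes "\<sigma> \<in> carrier (galois_group k K)"
  shows "bij_betw \<sigma> K K" "\<sigma> \<in> extensional K" "\<And>x. x \<in> k \<Longrightarrow> \<sigma> x = x"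
    and "\<And>x. x \<in> K \<Longrightarrow> \<sigma> x \<in> K"
    and "\<And>x y. x \<in> K \<Longrightarrow> y \<in> K \<Longrightarrow> \<sigma> (x + y) = \<sigma> x + \<sigma> y"
    and "\<And>x y. x \<in> K \<Longrightarrow> y \<in> K \<Longrightarrow> \<sigma> (x * y) = \<sigma> x * \<sigma> y"
proof -
  have "\<sigma> \<in> ring_iso (ring_on K) (ring_on K)"
    using assms by (simp add: galois_group_def)
  note iso = ring_iso_memE[OF this, unfolded ring_on_def, simplified]
  show "bij_betw \<sigma> K K" "\<And>x. x \<in> K \<Longrightarrow> \<sigma> x \<in> K"
    "\<And>x y. x \<in> K \<Longrightarrow> y \<in> K \<Longrightarrow> \<sigma> (x + y) = \<sigma> x + \<sigma> y"
    "\<And>x y. x \<in> K \<Longrightarrow> y \<in> K \<Longrightarrow> \<sigma> (x * y) = \<sigma> x * \<sigma> y"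
    by (simp_all add: iso)
  show "\<sigma> \<in> extensional K" "\<And>x. x \<in> k \<Longrightarrow> \<sigma> x = x"
    using assms by (simp_all add: galois_group_def)
qed

text \<open>For irrational \<open>z\<close>, the partial isomorphism that moves \<open>z\<close> to
  \<open>b\<close> extends to the graph of an automorphism of \<open>Qbar\<close>, which then does
  not fix \<open>z\<close>.\<close>

lemma fixed_field_absolute_galois_group:
  assumes z: "z \<in> Qbar" and fixed: "\<And>g. g \<in> carrier absolute_galois_group \<Longrightarrow> g z = z"
  shows "z \<in> \<rat>"
proof (rule ccontr)
  assume "z \<notin> \<rat>"
  have "algebraic z" using z by (simp add: Qbar_def)
  from this \<open>z \<notin> \<rat>\<close> obtain R b where R: "partial_iso R" "(z, b) \<in> R" and "b \<noteq> z"
    by (rule partial_iso_move_irrational)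
  obtain M where M: "partial_iso M" "R \<subseteq> M" "Domain M = Qbar" "Range M = Qbar"
    unfolding Qbar_def by (rule partial_iso_extend_total[OF R(1)])
  \<comment> \<open>The restriction gives \<open>undefined\<close> outside \<open>Qbar\<close>, as
    membership in \<open>extensional Qbar\<close> demands.\<close>
  define g where "g = (\<lambda>x\<in>Qbar. THE y. (x, y) \<in> M)"
  have g_eq: "g x = y" if xy: "(x, y) \<in> M" for x y
  proof -
    have "x \<in> Qbar" using xy M(3) by auto
    moreover have "(THE y. (x, y) \<in> M) = y"
      using xy partial_iso_left_unique[OF M(1) _ xy] by (rule the_equality)
    ultimately show ?thesis by (simp add: g_def)
  qed
  have graph: "(x, g x) \<in> M" if x: "x \<in> Qbar" for x
  proof -
    obtain y where "(x, y) \<in> M" using x M(3) by auto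
    then show ?thesis using g_eq by simp
  qed
  have "g \<in> ring_iso (ring_on Qbar) (ring_on Qbar)"
  proof (rule ring_iso_memI; simp add: ring_on_def)
    show g_Qbar: "g x \<in> Qbar" if "x \<in> Qbar" for x
      using graph[OF that] M(4) by auto
    show "g (x * y) = g x * g y" "g (x + y) = g x + g y" if "x \<in> Qbar" "y \<in> Qbar" for x y
      using g_eq[OF partial_iso_mult[OF M(1) graph[OF that(1)] graph[OF that(2)]]]
        g_eq[OF partial_iso_add[OF M(1) graph[OF that(1)] graph[OF that(2)]]]
      by simp_all
    show "g 1 = 1"
      by (intro g_eq partial_iso_rat M(1)) simp
    show "bij_betw g Qbar Qbar"
      unfolding bij_betw_def
    proof
      show "inj_on g Qbar"
      proof (rule inj_onI)
        fix x y assume "x \<in> Qbar" "y \<in> Qbar" "g x = g y"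
        then have "(x - y, 0) \<in> M"
          using partial_iso_diff[OF M(1) graph[of x] graph[of y]] by simp
        then have "x - y = 0" by (rule partial_iso_zero_right[OF M(1)])
        then show "x = y" by simp
      qed
      have "y \<in> g ` Qbar" if y: "y \<in> Qbar" for y
      proof -
        obtain x where x: "(x, y) \<in> M" using y M(4) by auto
        then show ?thesis using g_eq[OF x] M(3) by auto
      qed
      then show "g ` Qbar = Qbar" using g_Qbar by auto
    qed
  qed
  moreover have "g \<in> extensional Qbar" by (simp add: g_def)
  moreover have "g x = x" if "x \<in> \<rat>" for x
    by (intro g_eq partial_iso_rat M(1) that)
  ultimately have "g \<in> carrier absolute_galois_group"
    by (simp add: galois_group_def)
  then have "g z = z" by (rule fixed)
  moreover have "g z = b" using R(2) M(2) by (intro g_eq) auto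
  ultimately show False using \<open>b \<noteq> z\<close> by simp
qed

section \<open>Finiteness of Galois groups of number fields\<close>

lemma number_field_closed:
  assumes "number_field K"
  shows number_field_add: "x \<in> K \<Longrightarrow> y \<in> K \<Longrightarrow> x + y \<in> K"
    and number_field_mult: "x \<in> K \<Longrightarrow> y \<in> K \<Longrightarrow> x * y \<in> K"
    and number_field_power: "x \<in> K \<Longrightarrow> x ^ n \<in> K"
    and number_field_of_rat: "of_rat q \<in> K"
proof -
  obtain B where K: "K = rat_vs.span B" and field: "field (ring_on K)"
    using assms unfolding number_field_def by blast
  interpret field "ring_on K" by (rule field)
  show "x \<in> K \<Longrightarrow> y \<in> K \<Longrightarrow> x + y \<in> K"
    unfolding K by (rule rat_vs.span_add)
  have one: "1 \<in> K" using one_closed by (simp add: ring_on_def)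
  show mult: "x \<in> K \<Longrightarrow> y \<in> K \<Longrightarrow> x * y \<in> K" for x y
    using m_closed[of x y] by (simp add: ring_on_def)
  show "x \<in> K \<Longrightarrow> x ^ n \<in> K"
    by (induction n) (use one mult in auto)
  show "of_rat q \<in> K"
    using rat_vs.span_scale[of 1 B q] one K by simp
qed

lemma number_field_Rats: "number_field K \<Longrightarrow> \<rat> \<subseteq> K"
  using number_field_of_rat by (auto simp: Rats_def)

lemma number_field_algebraic:
  assumes "number_field K" and "x \<in> K"
  shows "algebraic x"
proof -
  obtain B where "finite B" "K = rat_vs.span B"
    using assms(1) unfolding number_field_def by blast
  then show ?thesis
    using number_field_power[OF assms] by (auto intro: algebraic_if_powers_in_finite_span)
qed

text \<open>Membership in \<open>K\<close> is carried through the induction because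
  \<open>\<sigma>\<close> is additive and multiplicative only on \<open>K\<close>.\<close>

lemma galois_group_poly:
  assumes K: "number_field k" "number_field K" "k \<subseteq> K" and \<sigma>: "\<sigma> \<in> carrier (galois_group k K)"
    and "x \<in> K" and "\<And>i. coeff p i \<in> k"
  shows "poly p x \<in> K \<and> \<sigma> (poly p x) = poly p (\<sigma> x)"
  using assms(6)
proof (induction p)
  case 0
  then show ?case
    using K(3) galois_groupD(3)[OF \<sigma>, of 0] by auto
next
  case (pCons a p)
  have a: "a \<in> k" using pCons.prems[of 0] by simp
  have "coeff p i \<in> k" for i using pCons.prems[of "Suc i"] by simp
  then have IH: "poly p x \<in> K" "\<sigma> (poly p x) = poly p (\<sigma> x)"
    using pCons.IH by auto
  have "a \<in> K" "x * poly p x \<in> K"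
    using a K(3) number_field_mult[OF K(2) \<open>x \<in> K\<close> IH(1)] by auto
  then show ?case
    using IH a \<open>x \<in> K\<close> by (simp add: galois_groupD[OF \<sigma>] number_field_add[OF K(2)])
qed

text \<open>An automorphism is determined by its values on a finite rational spanning set
  \<open>B\<close>, and sends each \<open>b\<close> to one of the finitely many roots of an integer
  polynomial vanishing at \<open>b\<close>.\<close>

lemma finite_galois_group:
  assumes K: "number_field k" "number_field K" "k \<subseteq> K"
  shows "finite (carrier (galois_group k K))"
proof -
  let ?G = "carrier (galois_group k K)"
  obtain B where B: "finite B" "K = rat_vs.span B"
    using K(2) unfolding number_field_def by blast
  then have "B \<subseteq> K" by (simp add: rat_vs.span_superset)
  have "\<exists>p. (\<forall>i. coeff p i \<in> \<int>) \<and> p \<noteq> 0 \<and> poly p b = 0" if "b \<in> B" for b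
    using number_field_algebraic[OF K(2), of b] \<open>B \<subseteq> K\<close> that unfolding algebraic_def by auto
  then obtain P where P: "\<And>b i. b \<in> B \<Longrightarrow> coeff (P b) i \<in> \<int>"
    "\<And>b. b \<in> B \<Longrightarrow> P b \<noteq> 0" "\<And>b. b \<in> B \<Longrightarrow> poly (P b) b = 0"
    by metis
  have images: "restrict \<sigma> B \<in> (\<Pi>\<^sub>E b\<in>B. {y. poly (P b) y = 0})" if \<sigma>: "\<sigma> \<in> ?G" for \<sigma>
  proof (subst restrict_PiE_iff, rule ballI)
    fix b assume b: "b \<in> B"
    have "coeff (P b) i \<in> k" for i
      using P(1)[OF b, of i] Ints_subset_Rats number_field_Rats[OF K(1)] by auto
    then have "poly (P b) (\<sigma> b) = \<sigma> (poly (P b) b)"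
      using galois_group_poly[OF K \<sigma>] b \<open>B \<subseteq> K\<close> by auto
    also have "\<dots> = 0"
      using P(3)[OF b] galois_groupD(3)[OF \<sigma>, of 0] number_field_Rats[OF K(1)] by auto
    finally show "\<sigma> b \<in> {y. poly (P b) y = 0}" by simp
  qed
  have fin: "finite (\<Pi>\<^sub>E b\<in>B. {y. poly (P b) y = 0})"
    using B(1) P(2) by (intro finite_PiE poly_roots_finite)
  have inj: "inj_on (\<lambda>\<sigma>. restrict \<sigma> B) ?G"
  proof (rule inj_onI)
    fix \<sigma> \<tau> assume \<sigma>: "\<sigma> \<in> ?G" and \<tau>: "\<tau> \<in> ?G" and eq: "restrict \<sigma> B = restrict \<tau> B"
    have "x \<in> K \<and> \<sigma> x = \<tau> x" if "x \<in> rat_vs.span B" for x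
      using that
    proof (induction rule: rat_vs.span_induct_alt)
      case base
      have "0 \<in> k" using number_field_Rats[OF K(1)] by auto
      then show ?case
        using K(3) galois_groupD(3)[OF \<sigma>] galois_groupD(3)[OF \<tau>] by auto
    next
      case (step c x y)
      have x: "x \<in> K" "\<sigma> x = \<tau> x"
        using step(1) \<open>B \<subseteq> K\<close> fun_cong[OF eq, of x] by auto
      have c: "of_rat c \<in> k" "of_rat c \<in> K" by (intro number_field_of_rat K)+
      have "of_rat c * x \<in> K" by (rule number_field_mult[OF K(2) c(2) x(1)])
      then show ?case
        using x c step(2)
        by (simp add: number_field_add[OF K(2)] galois_groupD(3,5,6)[OF \<sigma>] galois_groupD(3,5,6)[OF \<tau>])
    qed
    then show "\<sigma> = \<tau>"
      using galois_groupD(2)[OF \<sigma>] galois_groupD(2)[OF \<tau>] B(2) by (intro extensionalityI[of _ K]) auto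
  qed
  show ?thesis
    by (rule inj_on_finite[OF inj image_subsetI[OF images] fin])
qed

section \<open>Characters and Fourier inversion\<close>

text \<open>Additivity of \<open>g\<close> holds only on \<open>Qbar\<close>, so the induction also
  tracks that the partial sums are algebraic.\<close>

lemma absolute_galois_group_sum:
  assumes g: "g \<in> carrier absolute_galois_group" and "\<And>i. i \<in> I \<Longrightarrow> f i \<in> Qbar"
  shows "g (sum f I) = (\<Sum>i\<in>I. g (f i))"
  using assms(2)
proof (induction I rule: infinite_finite_induct)
  case (insert i I)
  then have "f i \<in> Qbar" "sum f I \<in> Qbar" by (auto simp: Qbar_def intro: algebraic_sum)
  then show ?case using insert galois_groupD(5)[OF g] by simp
qed (use galois_groupD(3)[OF g, of 0] in auto)

context
  fixes G :: "('g, 'b) monoid_scheme" (structure)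
  assumes group: "group G" and finite: "finite (carrier G)"
begin

interpretation group G by (rule group)

lemma character_mult:
  "\<psi> \<in> characters G \<Longrightarrow> \<sigma> \<in> carrier G \<Longrightarrow> \<tau> \<in> carrier G \<Longrightarrow> \<psi> (\<sigma> \<otimes> \<tau>) = \<psi> \<sigma> * \<psi> \<tau>"
  by (simp add: characters_def hom_def ring_on_def mult_of_def)

lemma character_nonzero: "\<psi> \<in> characters G \<Longrightarrow> \<sigma> \<in> carrier G \<Longrightarrow> \<psi> \<sigma> \<noteq> 0"
  by (auto simp: characters_def hom_def ring_on_def mult_of_def Pi_def)

lemma character_one: "\<psi> \<in> characters G \<Longrightarrow> \<psi> \<one> = 1"
  using character_mult[of \<psi> \<one> \<one>] character_nonzero[of \<psi> \<one>] by simp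

lemma character_inv: "\<psi> \<in> characters G \<Longrightarrow> \<sigma> \<in> carrier G \<Longrightarrow> \<psi> \<sigma> * \<psi> (inv \<sigma>) = 1"
  using character_mult[of \<psi> \<sigma> "inv \<sigma>"] by (simp add: character_one)

lemma character_extensional: "\<psi> \<in> characters G \<Longrightarrow> \<psi> \<in> extensional (carrier G)"
  by (simp add: characters_def)

lemma order_pos: "0 < order G"
  using finite one_closed by (auto simp: order_def card_gt_0_iff)

lemma character_root_of_unity:
  assumes "\<psi> \<in> characters G" and "\<sigma> \<in> carrier G"
  shows "\<psi> \<sigma> ^ order G = 1"
proof -
  have "\<psi> (\<sigma> [^] (n::nat)) = \<psi> \<sigma> ^ n" for n
    using assms by (induction n) (simp_all add: character_one character_mult)
  then show ?thesis
    using pow_order_eq_1[OF assms(2)] character_one[OF assms(1)] by metis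
qed

lemma character_algebraic:
  assumes "\<psi> \<in> characters G" and "\<sigma> \<in> carrier G"
  shows "\<psi> \<sigma> \<in> Qbar"
proof -
  have "algebraic (\<psi> \<sigma>)"
    by (rule algebraic_root[where p = "monom 1 (order G)" and y = 1])
       (use character_root_of_unity[OF assms] order_pos in \<open>simp_all add: poly_monom degree_monom_eq\<close>)
  then show ?thesis by (simp add: Qbar_def)
qed

text \<open>The value is a root of unity, hence on the unit circle, where conjugation is
  inversion.\<close>

lemma cnj_character:
  assumes "\<psi> \<in> characters G" and "\<sigma> \<in> carrier G"
  shows "cnj (\<psi> \<sigma>) = \<psi> (inv \<sigma>)"
proof -
  have "norm (\<psi> \<sigma>) ^ order G = 1"
    using character_root_of_unity[OF assms] by (metis norm_one norm_power)
  then have "norm (\<psi> \<sigma>) = 1"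
    using order_pos by (intro power_eq_imp_eq_base[of _ "order G" 1]) auto
  then have "\<psi> \<sigma> * cnj (\<psi> \<sigma>) = 1"
    by (simp add: complex_norm_square[symmetric])
  then show ?thesis
    using character_inv[OF assms] character_nonzero[OF assms] by (metis mult_left_cancel)
qed

text \<open>A character is an extensional function on a finite set with values in the finite set of
  roots of unity of order dividing \<open>order G\<close>.\<close>

lemma finite_characters: "finite (characters G)"
proof (rule finite_subset)
  show "characters G \<subseteq> (\<Pi>\<^sub>E \<sigma>\<in>carrier G. {z. z ^ order G = 1})"
    by (intro subsetI) (simp add: PiE_iff character_root_of_unity character_extensional)
  show "finite (\<Pi>\<^sub>E \<sigma>\<in>carrier G. {z::complex. z ^ order G = 1})"
    using order_pos by (intro finite_PiE finite finite_roots_unity) simp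
qed

text \<open>Translation by an element \<tau> at which the characters differ leaves the sum unchanged
  but multiplies it by a factor other than 1.\<close>

lemma character_orthogonality:
  assumes \<psi>: "\<psi> \<in> characters G" and \<phi>: "\<phi> \<in> characters G"
  shows "(\<Sum>\<sigma>\<in>carrier G. \<psi> \<sigma> * \<phi> (inv \<sigma>)) = (if \<psi> = \<phi> then of_nat (order G) else 0)"
proof (cases "\<psi> = \<phi>")
  case True
  then show ?thesis using character_inv[OF \<phi>] by (simp add: order_def)
next
  case False
  then obtain \<tau> where \<tau>: "\<tau> \<in> carrier G" "\<psi> \<tau> \<noteq> \<phi> \<tau>"
    using extensionalityI[OF character_extensional[OF \<psi>] character_extensional[OF \<phi>]] by blast
  let ?S = "\<Sum>\<sigma>\<in>carrier G. \<psi> \<sigma> * \<phi> (inv \<sigma>)"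
  have "bij_betw (\<lambda>\<sigma>. \<tau> \<otimes> \<sigma>) (carrier G) (carrier G)"
    using \<tau>(1) by (simp add: bij_betw_def inj_on_cmult surj_const_mult)
  then have "?S = (\<Sum>\<sigma>\<in>carrier G. \<psi> (\<tau> \<otimes> \<sigma>) * \<phi> (inv (\<tau> \<otimes> \<sigma>)))"
    by (simp add: sum.reindex_bij_betw[where g = "\<lambda>\<sigma>. \<psi> \<sigma> * \<phi> (inv \<sigma>)"])
  also have "\<dots> = \<psi> \<tau> * \<phi> (inv \<tau>) * ?S"
    unfolding sum_distrib_left
    by (intro sum.cong) (use \<psi> \<phi> \<tau> in \<open>auto simp: inv_mult_group character_mult\<close>)
  finally have "(1 - \<psi> \<tau> * \<phi> (inv \<tau>)) * ?S = 0" by (simp add: algebra_simps)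
  moreover have "\<psi> \<tau> * \<phi> (inv \<tau>) \<noteq> 1"
    using character_inv[OF \<phi> \<tau>(1)] \<tau>(2) by (metis mult_right_cancel mult_zero_right zero_neq_one)
  ultimately show ?thesis using False by simp
qed

text \<open>Two inversions cancel: conjugation replaces \<tau> by its inverse, and the coefficient
  at \<sigma> selects the \<tau> whose inverse is \<sigma>.\<close>

lemma char_idempotent_conj_char:
  assumes "\<psi> \<in> characters G"
  shows "char_idempotent G (conj_char G \<psi>) \<sigma> = (if \<sigma> \<in> carrier G then \<psi> \<sigma> / of_nat (order G) else 0)"
proof -
  have "(\<Sum>\<tau>\<in>carrier G. conj_char G \<psi> \<tau> * gr_of (inv \<tau>) \<sigma>) =
        (\<Sum>\<tau>\<in>carrier G. if \<sigma> \<in> carrier G \<and> \<tau> = inv \<sigma> then \<psi> (inv \<tau>) else 0)"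
    by (intro sum.cong) (auto simp: conj_char_def compose_def gr_of_def cnj_character[OF assms])
  also have "\<dots> = (if \<sigma> \<in> carrier G then \<psi> \<sigma> else 0)"
    using finite by (auto simp: sum.delta)
  finally show ?thesis by (simp add: char_idempotent_def order_def)
qed

lemma compose_character:
  assumes g: "g \<in> carrier absolute_galois_group" and \<psi>: "\<psi> \<in> characters G"
  shows "compose (carrier G) g \<psi> \<in> characters G"
proof -
  have inj: "inj_on g Qbar" using galois_groupD(1)[OF g] by (simp add: bij_betw_def)
  have "g (\<psi> \<sigma>) \<noteq> 0" if "\<sigma> \<in> carrier G" for \<sigma>
  proof
    assume "g (\<psi> \<sigma>) = 0"
    then have "g (\<psi> \<sigma>) = g 0" using galois_groupD(3)[OF g, of 0] by simp
    then have "\<psi> \<sigma> = 0"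
      using inj_onD[OF inj] character_algebraic[OF \<psi> that] by (simp add: Qbar_def)
    then show False using character_nonzero[OF \<psi> that] by simp
  qed
  then show ?thesis
    using character_algebraic[OF \<psi>] character_mult[OF \<psi>] galois_groupD(6)[OF g]
    by (auto simp: characters_def hom_def ring_on_def mult_of_def compose_def)
qed

text \<open>Character values lie in \<open>Qbar\<close>, where \<open>g\<close> is injective, so
  composition with \<open>g\<close> is an injective self-map of a finite set.\<close>

lemma bij_betw_compose_characters:
  assumes g: "g \<in> carrier absolute_galois_group"
  shows "bij_betw (compose (carrier G) g) (characters G) (characters G)"
proof -
  have inj: "inj_on g Qbar" using galois_groupD(1)[OF g] by (simp add: bij_betw_def)
  have "inj_on (compose (carrier G) g) (characters G)"
  proof (rule inj_onI)
    fix \<psi> \<phi> assume \<psi>: "\<psi> \<in> characters G" and \<phi>: "\<phi> \<in> characters G"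
      and eq: "compose (carrier G) g \<psi> = compose (carrier G) g \<phi>"
    have "\<psi> \<sigma> = \<phi> \<sigma>" if "\<sigma> \<in> carrier G" for \<sigma>
      using fun_cong[OF eq, of \<sigma>] that character_algebraic \<psi> \<phi> by (auto simp: compose_eq dest: inj_onD[OF inj])
    then show "\<psi> = \<phi>"
      by (rule extensionalityI[OF character_extensional[OF \<psi>] character_extensional[OF \<phi>]])
  qed
  moreover have "compose (carrier G) g ` characters G \<subseteq> characters G"
    using compose_character[OF g] by blast
  ultimately show ?thesis
    unfolding bij_betw_def using endo_inj_surj[OF finite_characters] by blast
qed

text \<open>A statement of Fourier analysis about an arbitrary function \<open>A\<close> on the
  characters; the Stark quotient is substituted for \<open>A\<close> at the end.\<close>

lemma galois_equivariant_iff_rational: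
  fixes A :: "('g \<Rightarrow> complex) \<Rightarrow> complex"
  defines "\<beta> \<equiv> (\<lambda>\<sigma>. \<Sum>\<psi>\<in>characters G. A \<psi> * char_idempotent G (conj_char G \<psi>) \<sigma>)"
  shows "(\<forall>\<psi>\<in>characters G. A \<psi> \<in> Qbar \<and>
      (\<forall>g\<in>carrier absolute_galois_group. g (A \<psi>) = A (compose (carrier G) g \<psi>)))
    \<longleftrightarrow> \<beta> \<in> group_ring \<rat> G"
    (is "?equivariant \<longleftrightarrow> ?rational")
proof
  have \<beta>: "\<beta> \<sigma> = (\<Sum>\<psi>\<in>characters G. A \<psi> * (\<psi> \<sigma> * (1 / of_nat (order G))))"
    if "\<sigma> \<in> carrier G" for \<sigma>
    using that by (simp add: \<beta>_def char_idempotent_conj_char)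
  have Qbar_times: "x * y \<in> Qbar" if "x \<in> Qbar" "y \<in> Qbar" for x y
    using that algebraic_times by (simp add: Qbar_def)
  have Rats_Qbar: "x \<in> Qbar" if "x \<in> \<rat>" for x
    using that by (simp add: Qbar_def rat_imp_algebraic)
  {
    assume equivariant: ?equivariant
    have "\<beta> \<sigma> \<in> \<rat>" if \<sigma>: "\<sigma> \<in> carrier G" for \<sigma>
    proof (rule fixed_field_absolute_galois_group)
      let ?n = "1 / of_nat (order G) :: complex"
      have n: "?n \<in> \<rat>" by simp
      have summand: "A \<psi> \<in> Qbar" "\<psi> \<sigma> * ?n \<in> Qbar" "A \<psi> * (\<psi> \<sigma> * ?n) \<in> Qbar"
        if "\<psi> \<in> characters G" for \<psi>
        using that equivariant character_algebraic[OF that \<sigma>] Rats_Qbar[OF n] by (blast intro: Qbar_times)+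
      then show "\<beta> \<sigma> \<in> Qbar"
        unfolding \<beta>[OF \<sigma>] Qbar_def by (auto intro: algebraic_sum)
      fix g assume g: "g \<in> carrier absolute_galois_group"
      have "g (\<beta> \<sigma>) = (\<Sum>\<psi>\<in>characters G. g (A \<psi> * (\<psi> \<sigma> * ?n)))"
        unfolding \<beta>[OF \<sigma>] using summand(3) by (rule absolute_galois_group_sum[OF g])
      also have "\<dots> = (\<Sum>\<psi>\<in>characters G.
          A (compose (carrier G) g \<psi>) * (compose (carrier G) g \<psi> \<sigma> * ?n))"
      proof (rule sum.cong)
        fix \<psi> assume \<psi>: "\<psi> \<in> characters G"
        have "g (A \<psi> * (\<psi> \<sigma> * ?n)) = g (A \<psi>) * (g (\<psi> \<sigma>) * g ?n)"
          using summand[OF \<psi>] character_algebraic[OF \<psi> \<sigma>] Rats_Qbar[OF n]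
          by (simp only: galois_groupD(6)[OF g])
        then show "g (A \<psi> * (\<psi> \<sigma> * ?n)) =
            A (compose (carrier G) g \<psi>) * (compose (carrier G) g \<psi> \<sigma> * ?n)"
          using equivariant \<psi> g \<sigma> galois_groupD(3)[OF g n] by (simp add: compose_eq)
      qed simp
      \<comment> \<open>The sum is that for \<open>\<beta> \<sigma>\<close>, reindexed along the
        permutation of the characters induced by \<open>g\<close>.\<close>
      also have "\<dots> = \<beta> \<sigma>"
        unfolding \<beta>[OF \<sigma>]
        by (rule sum.reindex_bij_betw[OF bij_betw_compose_characters[OF g]])
      finally show "g (\<beta> \<sigma>) = \<beta> \<sigma>" .
    qed
    moreover have "\<beta> \<sigma> = 0" if "\<sigma> \<notin> carrier G" for \<sigma>
      using that by (simp add: \<beta>_def char_idempotent_conj_char)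
    ultimately show ?rational by (simp add: group_ring_def)
  }
  assume ?rational
  then have rat: "\<beta> \<sigma> \<in> \<rat>" if "\<sigma> \<in> carrier G" for \<sigma>
    using that by (simp add: group_ring_def)
  \<comment> \<open>Fourier inversion: after exchanging the sums, orthogonality leaves only the term
    of \<open>\<phi>\<close>. Applied to \<open>\<phi>\<close> and to its composite with
    \<open>g\<close>, it yields both sides of the equivariance.\<close>
  have inversion: "A \<phi> = (\<Sum>\<sigma>\<in>carrier G. \<beta> \<sigma> * \<phi> (inv \<sigma>))" if \<phi>: "\<phi> \<in> characters G" for \<phi>
  proof -
    have "(\<Sum>\<sigma>\<in>carrier G. \<beta> \<sigma> * \<phi> (inv \<sigma>)) =
        (\<Sum>\<sigma>\<in>carrier G. \<Sum>\<psi>\<in>characters G. A \<psi> / of_nat (order G) * (\<psi> \<sigma> * \<phi> (inv \<sigma>)))"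
      by (intro sum.cong refl) (simp only: \<beta> sum_distrib_right, simp add: mult_ac)
    also have "\<dots> = (\<Sum>\<psi>\<in>characters G. A \<psi> / of_nat (order G) * (\<Sum>\<sigma>\<in>carrier G. \<psi> \<sigma> * \<phi> (inv \<sigma>)))"
      by (subst sum.swap) (simp add: sum_distrib_left)
    also have "\<dots> = (\<Sum>\<psi>\<in>characters G. if \<psi> = \<phi> then A \<phi> else 0)"
      using order_pos by (intro sum.cong) (simp_all add: character_orthogonality[OF _ \<phi>])
    also have "\<dots> = A \<phi>" using finite_characters \<phi> by simp
    finally show ?thesis by simp
  qed
  show ?equivariant
  proof (intro ballI conjI)
    fix \<phi> assume \<phi>: "\<phi> \<in> characters G"
    have summand: "\<phi> (inv \<sigma>) \<in> Qbar" "\<beta> \<sigma> \<in> Qbar" "\<beta> \<sigma> * \<phi> (inv \<sigma>) \<in> Qbar" if "\<sigma> \<in> carrier G" for \<sigma>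
      using character_algebraic[OF \<phi> inv_closed[OF that]] Rats_Qbar[OF rat[OF that]] by (blast intro: Qbar_times)+
    then show "A \<phi> \<in> Qbar"
      unfolding inversion[OF \<phi>] Qbar_def by (auto intro: algebraic_sum)
    fix g assume g: "g \<in> carrier absolute_galois_group"
    have "g (A \<phi>) = (\<Sum>\<sigma>\<in>carrier G. g (\<beta> \<sigma> * \<phi> (inv \<sigma>)))"
      unfolding inversion[OF \<phi>] using summand(3) by (rule absolute_galois_group_sum[OF g])
    \<comment> \<open>The coefficients \<open>\<beta> \<sigma>\<close> are rational, so
      \<open>g\<close> acts on the character values alone.\<close>
    also have "\<dots> = (\<Sum>\<sigma>\<in>carrier G. \<beta> \<sigma> * compose (carrier G) g \<phi> (inv \<sigma>))"
      using summand rat by (intro sum.cong) (simp_all add: galois_groupD(3,6)[OF g] compose_eq)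
    also have "\<dots> = A (compose (carrier G) g \<phi>)"
      by (rule inversion[OF compose_character[OF g \<phi>], symmetric])
    finally show "g (A \<phi>) = A (compose (carrier G) g \<phi>)" .
  qed
qed

end

theorem theorem3p14:
  fixes k K :: "'a::field_char_0 set"
    and S :: "'a place set"
    and \<epsilon> :: "'a place \<Rightarrow> 'a"
  assumes "number_field k" and "number_field K" and "abelian_extension k K"
    and "finite S" and "S \<subseteq> places k" and "infinite_places k \<subseteq> S"
    and "artin_system k K S \<epsilon>"
  shows
    "(\<forall>\<psi>\<in>characters (galois_group k K).
        stark_quotient k K S \<epsilon> \<psi> \<in> Qbar \<and>
        (\<forall>g\<in>carrier absolute_galois_group.
           g (stark_quotient k K S \<epsilon> \<psi>) =
           stark_quotient k K S \<epsilon> (compose (carrier (galois_group k K)) g \<psi>)))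
     \<longleftrightarrow> stark_element k K S \<epsilon> \<in> group_ring \<rat> (galois_group k K)"
proof -
  have "k \<subseteq> K" and group: "group (galois_group k K)"
    using assms(3) by (simp_all add: abelian_extension_def comm_group_def)
  show ?thesis
    unfolding stark_element_def
    by (rule galois_equivariant_iff_rational[OF group finite_galois_group[OF assms(1,2) \<open>k \<subseteq> K\<close>]])
qed

end
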